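(* Let $k,\ell\ge1$. There is a bijection between the set of partitions $\lambda\in P(k,\ell)$ in which every nonzero part has even multiplicity and parity opposite to $\ell$ and (when $\ell$ is odd) $0$ has even multiplicity, and the set of self-complementary partitions in $P(k,\ell)$.
   Context: $P(k,\ell)$ is the set of partitions $\lambda=(\lambda_1,\dots,\lambda_k)$ with $\ell\ge\lambda_1\ge\cdots\ge\lambda_k\ge0$ (exactly $k$ parts; zero parts are counted in multiplicities). The complement of $\lambda$ in the $k\times\ell$ rectangle is $(\ell-\lambda_k,\ell-\lambda_{k-1},\dots,\ell-\lambda_1)$; $\lambda$ is self-complementary if it equals its complement. (The partitions in the first set are precisely the critical cells of a Morse matching on $P(k,\ell)$ considered in the paper.) *)

theory Defs
  imports Main
begin

text \<open>Partitions with exactly \<open>k\<close> parts, written as weakly decreasing lists of length \<open>k\<close>;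
  trailing zeros are kept, so 0 has a multiplicity like any other part.\<close>

definition box_partitions :: "nat \<Rightarrow> nat \<Rightarrow> nat list set" where
  "box_partitions k l =
     {xs. length xs = k \<and> sorted_wrt (\<ge>) xs \<and> (\<forall>x\<in>set xs. x \<le> l)}"

text \<open>The subtraction does not truncate on \<open>box_partitions k l\<close>, whose parts are at most \<open>l\<close>.\<close>

definition box_complement :: "nat \<Rightarrow> nat list \<Rightarrow> nat list" where
  "box_complement l xs = map (\<lambda>x. l - x) (rev xs)"

definition self_complementary :: "nat \<Rightarrow> nat list \<Rightarrow> bool" where
  "self_complementary l xs \<longleftrightarrow> box_complement l xs = xs"

definition critical_partition :: "nat \<Rightarrow> nat list \<Rightarrow> bool" where
  "critical_partition l xs \<longleftrightarrow>
     (\<forall>x\<in>set xs. x \<noteq> 0 \<longrightarrow> even (count_list xs x) \<and> (even x \<longleftrightarrow> odd l)) \<and>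
     (odd l \<longrightarrow> even (count_list xs 0))"

end

theory Submission
  imports Defs
begin

text \<open>When \<open>k\<close> and \<open>l\<close> are both odd, both sets are empty. Otherwise both are in bijection with the
  partitions in the box of size \<open>k div 2\<close> by \<open>l div 2\<close>: a self-complementary partition is
  determined by its first \<open>k div 2\<close> parts, which are at least \<open>l / 2\<close>; a critical partition
  is a list of \<open>k div 2\<close> pairs of equal parts, followed by a single \<open>0\<close> if \<open>k\<close> is odd, and
  exactly \<open>l div 2 + 1\<close> values are available for these parts.\<close>

section \<open>Doubling the entries of a list and halving it again\<close>

fun double_list :: "'a list \<Rightarrow> 'a list" where
  "double_list [] = []"
| "double_list (x # xs) = x # x # double_list xs"

text \<open>A last entry without partner is dropped, so that this undoes \<open>double_list\<close>
  even after a single entry has been appended.\<close>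

fun every_other :: "'a list \<Rightarrow> 'a list" where
  "every_other (x # y # zs) = x # every_other zs"
| "every_other _ = []"

lemma sorted_wrt_ge_map_mono:
  "mono f \<Longrightarrow> sorted_wrt (\<ge>) xs \<Longrightarrow> sorted_wrt (\<ge>) (map f xs)"
  by (induction xs) (auto dest: monoD)

lemma sorted_wrt_ge_map_rev_antimono:
  "antimono f \<Longrightarrow> sorted_wrt (\<ge>) xs \<Longrightarrow> sorted_wrt (\<ge>) (map f (rev xs))"
  by (induction xs) (auto simp: sorted_wrt_append dest: antimonoD)

lemma length_double_list [simp]: "length (double_list xs) = 2 * length xs"
  by (induction xs) auto

lemma set_double_list [simp]: "set (double_list xs) = set xs"
  by (induction xs) auto

lemma count_list_double_list [simp]: "count_list (double_list xs) x = 2 * count_list xs x"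
  by (induction xs) auto

lemma sorted_wrt_double_list:
  "reflp P \<Longrightarrow> sorted_wrt P xs \<Longrightarrow> sorted_wrt P (double_list xs)"
  by (induction xs) (auto dest: reflpD)

lemma length_every_other [simp]: "length (every_other xs) = length xs div 2"
  by (induction xs rule: every_other.induct) auto

lemma set_every_other_subset: "set (every_other xs) \<subseteq> set xs"
  by (induction xs rule: every_other.induct) auto

lemma sorted_wrt_every_other: "sorted_wrt P xs \<Longrightarrow> sorted_wrt P (every_other xs)"
  by (induction xs rule: every_other.induct) (auto dest: subsetD[OF set_every_other_subset])

lemma every_other_double_list_append:
  "length ys \<le> 1 \<Longrightarrow> every_other (double_list xs @ ys) = xs"
  by (induction xs) (cases ys; auto)+

text \<open>Sorting puts equal parts side by side, so the copies of each nonzero part split into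
  adjacent pairs. Zeros come last, hence an entry left over at odd length is a
  \<open>0\<close>.\<close>

lemma double_list_every_other:
  fixes xs :: "nat list"
  assumes "sorted_wrt (\<ge>) xs"
    and "\<And>x. x \<in> set xs \<Longrightarrow> x \<noteq> 0 \<Longrightarrow> even (count_list xs x)"
  shows "double_list (every_other xs) @ (if odd (length xs) then [0] else []) = xs"
  using assms
proof (induction xs rule: every_other.induct)
  case (1 x y zs)
  have eq: "y = x"
  proof (cases "x = 0")
    case False
    have "x \<in> set (y # zs)"
    proof (rule ccontr)
      assume "x \<notin> set (y # zs)"
      then have "count_list (x # y # zs) x = 1" by (auto simp: count_list_0_iff)
      with "1.prems"(2)[of x] False show False by simp
    qed
    \<comment> \<open>A further copy of \<open>x\<close> lies at or after \<open>y\<close>, so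
      \<open>y\<close> is squeezed between two copies of \<open>x\<close>.\<close>
    with "1.prems"(1) show ?thesis by auto
  qed (use "1.prems"(1) in auto)
  have "even (count_list zs z)" if "z \<in> set zs" "z \<noteq> 0" for z
    using "1.prems"(2)[of z] that eq by (auto split: if_splits)
  with 1 eq show ?case by simp
next
  \<comment> \<open>A lone nonzero entry would have multiplicity one.\<close>
  case ("2_2" x)
  then show ?case by fastforce
qed simp

section \<open>Emptiness of both sets for odd \<open>k\<close> and odd \<open>l\<close>\<close>

text \<open>For odd \<open>k\<close> the pairing leaves one single \<open>0\<close>, so
  \<open>0\<close> has odd multiplicity, which odd \<open>l\<close> forbids.\<close>

lemma critical_partition_imp_even:
  assumes "xs \<in> box_partitions k l" "critical_partition l xs"
  shows "even k \<or> even l"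
proof (rule ccontr)
  assume odd: "\<not> (even k \<or> even l)"
  then have xs: "double_list (every_other xs) @ [0] = xs"
    using double_list_every_other[of xs] assms
    by (auto simp: box_partitions_def critical_partition_def)
  have "count_list (double_list (every_other xs) @ [0]) 0 = 2 * count_list (every_other xs) 0 + 1"
    by simp
  with xs odd assms(2) show False by (simp add: critical_partition_def)
qed

lemma self_complementary_nth:
  assumes "self_complementary l xs" "i < length xs"
  shows "xs ! i = l - xs ! (length xs - Suc i)"
proof -
  have "xs ! i = map (\<lambda>x. l - x) (rev xs) ! i"
    using assms(1) by (simp add: self_complementary_def box_complement_def)
  with assms(2) show ?thesis by (simp add: rev_nth)
qed

text \<open>For odd \<open>k\<close> the middle part is its own mirror image, so twice this part is
  \<open>l\<close>.\<close>

lemma self_complementary_imp_even: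
  assumes "xs \<in> box_partitions k l" "self_complementary l xs"
  shows "even k \<or> even l"
proof (rule ccontr)
  assume odd: "\<not> (even k \<or> even l)"
  have len: "length xs = k" using assms(1) by (simp add: box_partitions_def)
  define i where "i = k div 2"
  have i: "i < k" "k - Suc i = i" using odd by (auto simp: i_def elim!: oddE)
  have "xs ! i \<le> l" using assms(1) len i(1) by (auto simp: box_partitions_def)
  with self_complementary_nth[OF assms(2), of i] len i odd show False
    by simp presburger
qed

section \<open>Bijections with the box of half the size\<close>

lemma bij_betw_critical_partitions:
  assumes "even k \<or> even l"
  shows "\<exists>f. bij_betw f (box_partitions (k div 2) (l div 2))
                        {xs \<in> box_partitions k l. critical_partition l xs}"
proof -
  \<comment> \<open>\<open>g\<close> enumerates \<open>0\<close> and the numbers of parity opposite to \<open>l\<close>; the truncation \<open>0 - 1 = 0\<close>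
    is intended.\<close>
  define g where "g y = 2 * y - (if even l then 1 else 0)" for y :: nat
  \<comment> \<open>Halving with rounding up inverts \<open>g\<close> for both parities of
    \<open>l\<close>.\<close>
  define h where "h x = (x + 1) div 2" for x :: nat
  define t :: "nat list" where "t = (if odd k then [0] else [])"
  define f where "f ys = double_list (map g ys) @ t" for ys
  have hg: "h (g y) = y" for y by (auto simp: g_def h_def)
  have gh: "g (h x) = x" if "x \<noteq> 0 \<longrightarrow> (even x \<longleftrightarrow> odd l)" for x
    using that by (cases "x = 0") (auto simp: g_def h_def elim!: oddE evenE)
  have gmono: "mono g" by (auto simp: g_def intro!: monoI)
  have g_le: "g y \<le> l" if "y \<le> l div 2" for y using that by (auto simp: g_def)
  have g_parity: "even (g y) \<longleftrightarrow> odd l" if "g y \<noteq> 0" for y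
    using that by (auto simp: g_def split: if_splits)
  have hmono: "mono h" by (auto simp: h_def intro!: monoI div_le_mono)
  have h_le: "h x \<le> l div 2" if "x \<le> l" "x \<noteq> 0 \<longrightarrow> (even x \<longleftrightarrow> odd l)" for x
  proof (cases "x = 0")
    case False
    with that show ?thesis unfolding h_def by presburger
  qed (simp add: h_def)
  have "bij_betw f (box_partitions (k div 2) (l div 2))
          {xs \<in> box_partitions k l. critical_partition l xs}"
  proof (rule bij_betw_byWitness[where f' = "map h \<circ> every_other"])
    show "\<forall>ys\<in>box_partitions (k div 2) (l div 2). (map h \<circ> every_other) (f ys) = ys"
      by (simp add: f_def t_def every_other_double_list_append hg comp_def)
    show "\<forall>xs\<in>{xs \<in> box_partitions k l. critical_partition l xs}.
            f ((map h \<circ> every_other) xs) = xs"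
    proof clarify
      fix xs assume xs: "xs \<in> box_partitions k l" "critical_partition l xs"
      have "map g (map h (every_other xs)) = every_other xs"
        using xs(2) subsetD[OF set_every_other_subset[of xs]]
        by (simp add: critical_partition_def map_idI gh)
      moreover have "double_list (every_other xs) @ t = xs"
        using double_list_every_other[of xs] xs
        by (auto simp: box_partitions_def critical_partition_def t_def)
      ultimately show "f ((map h \<circ> every_other) xs) = xs"
        by (simp add: f_def del: map_map)
    qed
    show "f ` box_partitions (k div 2) (l div 2)
            \<subseteq> {xs \<in> box_partitions k l. critical_partition l xs}"
    proof clarify
      fix ys assume ys: "ys \<in> box_partitions (k div 2) (l div 2)"
      have "sorted_wrt (\<ge>) (map g ys)"
        using ys by (simp add: box_partitions_def sorted_wrt_ge_map_mono gmono)
      then have "sorted_wrt (\<ge>) (f ys)"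
        by (auto simp: f_def t_def sorted_wrt_append intro!: sorted_wrt_double_list reflpI)
      then have "f ys \<in> box_partitions k l"
        using ys by (auto simp: box_partitions_def f_def t_def g_le)
      \<comment> \<open>For odd \<open>k\<close> the appended \<open>0\<close> makes the
        multiplicity of \<open>0\<close> odd; \<open>assms\<close> then makes \<open>l\<close> even,
        where this is allowed.\<close>
      moreover have "critical_partition l (f ys)"
        using assms g_parity by (auto simp: critical_partition_def f_def t_def)
      ultimately show "f ys \<in> box_partitions k l \<and> critical_partition l (f ys)" ..
    qed
    show "(map h \<circ> every_other) ` {xs \<in> box_partitions k l. critical_partition l xs}
            \<subseteq> box_partitions (k div 2) (l div 2)"
    proof clarify
      fix xs assume xs: "xs \<in> box_partitions k l" "critical_partition l xs"
      have "sorted_wrt (\<ge>) (every_other xs)"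
        using xs(1) by (simp add: box_partitions_def sorted_wrt_every_other)
      then have "sorted_wrt (\<ge>) (map h (every_other xs))"
        by (simp add: sorted_wrt_ge_map_mono hmono)
      moreover have "h x \<le> l div 2" if "x \<in> set (every_other xs)" for x
        using subsetD[OF set_every_other_subset that] xs
        by (simp add: box_partitions_def critical_partition_def h_le)
      ultimately show "(map h \<circ> every_other) xs \<in> box_partitions (k div 2) (l div 2)"
        using xs(1) by (auto simp: box_partitions_def)
    qed
  qed
  then show ?thesis by blast
qed

lemma bij_betw_self_complementary_partitions:
  assumes "even k \<or> even l"
  shows "\<exists>f. bij_betw f (box_partitions (k div 2) (l div 2))
                        {xs \<in> box_partitions k l. self_complementary l xs}"
proof -
  define m where "m = k div 2"
  \<comment> \<open>\<open>a\<close> and \<open>b\<close> are \<open>l / 2\<close> rounded up and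
    down, so the complement of a part \<open>y + a\<close> is \<open>b - y\<close>.\<close>
  define a where "a = (l + 1) div 2"
  define b where "b = l div 2"
  have ab: "a + b = l" "b \<le> a" by (auto simp: a_def b_def)
  \<comment> \<open>For odd \<open>k\<close> the middle part must equal its complement; here
    \<open>l\<close> is even and \<open>b\<close> is exactly \<open>l / 2\<close>.\<close>
  define t where "t = (if odd k then [b] else [])"
  define f where "f ys = map (\<lambda>y. y + a) ys @ t @ map (\<lambda>y. b - y) (rev ys)" for ys
  define f' where "f' xs = map (\<lambda>x. x - a) (take m xs)" for xs
  have t_mid: "odd k \<Longrightarrow> a = b" using assms by (auto simp: a_def b_def)
  have k: "k = 2 * m + length t" by (auto simp: m_def t_def)
  \<comment> \<open>A part in the first half is at least its mirror part, and the two sum to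
    \<open>l\<close>. Hence the subtraction in \<open>f'\<close> does not truncate.\<close>
  have a_le_nth: "a \<le> xs ! i"
    if "xs \<in> box_partitions k l" "self_complementary l xs" "i < m" for xs i
  proof -
    have len: "length xs = k" using that(1) by (simp add: box_partitions_def)
    have "i < k - Suc i" "k - Suc i < k" using that(3) k by auto
    then have "xs ! (k - Suc i) \<le> xs ! i"
      using that(1) len sorted_wrt_nth_less by (fastforce simp: box_partitions_def)
    moreover have "xs ! i = l - xs ! (k - Suc i)"
      using self_complementary_nth[OF that(2), of i] len that(3) k by simp
    ultimately show ?thesis unfolding a_def by linarith
  qed
  have "bij_betw f (box_partitions m b) {xs \<in> box_partitions k l. self_complementary l xs}"
  proof (rule bij_betw_byWitness[where f' = f'])
    show "\<forall>ys\<in>box_partitions m b. f' (f ys) = ys"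
      by (auto simp: f_def f'_def box_partitions_def comp_def)
    show "\<forall>xs\<in>{xs \<in> box_partitions k l. self_complementary l xs}. f (f' xs) = xs"
    proof clarify
      fix xs assume xs: "xs \<in> box_partitions k l" "self_complementary l xs"
      have len: "length xs = k" using xs(1) by (simp add: box_partitions_def)
      have len': "length (f' xs) = m" using len k by (simp add: f'_def)
      have f'_nth: "f' xs ! i = xs ! i - a" if "i < m" for i
        using that len k by (simp add: f'_def)
      show "f (f' xs) = xs"
      proof (rule nth_equalityI)
        show "length (f (f' xs)) = length xs" using len len' k by (simp add: f_def)
        fix i assume "i < length (f (f' xs))"
        then have i: "i < k" using len' k by (simp add: f_def)
        \<comment> \<open>The raised first half, the middle entry, and the reflected second
          half.\<close>
        consider "i < m" | "i = m" "odd k" | "m + length t \<le> i"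
          by (cases i m rule: linorder_cases; cases "odd k") (auto simp: t_def)
        then show "f (f' xs) ! i = xs ! i"
        proof cases
          case 1
          then show ?thesis
            using len' a_le_nth[OF xs] by (simp add: f_def nth_append f'_nth)
        next
          case 2
          have "xs ! m \<le> l" using xs(1) len i 2 by (auto simp: box_partitions_def)
          moreover have "k - Suc m = m" using 2 by (auto simp: m_def elim!: oddE)
          then have "xs ! m = l - xs ! m"
            using self_complementary_nth[OF xs(2), of m] len i 2(1) by simp
          ultimately have "xs ! m = b" unfolding b_def by linarith
          with 2 len' show ?thesis by (simp add: f_def t_def nth_append)
        next
          case 3
          \<comment> \<open>The mirror index of \<open>i\<close>, which lies in the first
            half.\<close>
          define j where "j = k - Suc i"
          have out: "\<not> i < m" "\<not> i - m < length t" "i - m - length t < m"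
            using 3 i k by auto
          have j: "j < m" "m - Suc (i - m - length t) = j" using 3 i k by (auto simp: j_def)
          have "f (f' xs) ! i = b - (xs ! j - a)"
            using out i j k len' f'_nth[of j] by (simp add: f_def nth_append rev_nth)
          also have "\<dots> = l - xs ! j"
            using a_le_nth[OF xs j(1)] ab by simp
          also have "\<dots> = xs ! i"
            using self_complementary_nth[OF xs(2), of i] len i by (simp add: j_def)
          finally show ?thesis .
        qed
      qed
    qed
    show "f ` box_partitions m b \<subseteq> {xs \<in> box_partitions k l. self_complementary l xs}"
    proof clarify
      fix ys assume ys: "ys \<in> box_partitions m b"
      then have le: "y \<le> b" if "y \<in> set ys" for y using that by (auto simp: box_partitions_def)
      have sorted: "sorted_wrt (\<ge>) ys" using ys by (simp add: box_partitions_def)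
      have "sorted_wrt (\<ge>) (map (\<lambda>y. y + a) ys)" using sorted by (simp add: sorted_wrt_map)
      moreover have "sorted_wrt (\<ge>) (map (\<lambda>y. b - y) (rev ys))"
        using sorted by (intro sorted_wrt_ge_map_rev_antimono antimonoI) auto
      \<comment> \<open>Entries of the first block are at least \<open>a\<close>, those of the last
        at most \<open>b\<close>, and a middle entry is \<open>b\<close> itself.\<close>
      ultimately have sorted_f: "sorted_wrt (\<ge>) (f ys)"
        using ab t_mid by (auto simp: f_def t_def sorted_wrt_append)
      have "length (f ys) = k"
        using ys k by (simp add: box_partitions_def f_def)
      moreover have "x \<le> l" if "x \<in> set (f ys)" for x
        using that le ab by (fastforce simp: f_def t_def split: if_splits)
      ultimately have "f ys \<in> box_partitions k l"
        using sorted_f by (simp add: box_partitions_def)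
      \<comment> \<open>Complementing exchanges the outer blocks, as \<open>y \<le> b\<close> and
        \<open>a + b = l\<close>, and fixes the middle entry, as \<open>a = b\<close> for odd
        \<open>k\<close>.\<close>
      moreover have "self_complementary l (f ys)"
        using le ab t_mid
        by (auto simp: self_complementary_def box_complement_def f_def t_def rev_map comp_def)
      ultimately show "f ys \<in> box_partitions k l \<and> self_complementary l (f ys)" ..
    qed
    show "f' ` {xs \<in> box_partitions k l. self_complementary l xs} \<subseteq> box_partitions m b"
    proof clarify
      fix xs assume xs: "xs \<in> box_partitions k l" "self_complementary l xs"
      have "sorted_wrt (\<ge>) (take m xs)"
        using xs(1) by (simp add: box_partitions_def sorted_wrt_take)
      then have "sorted_wrt (\<ge>) (f' xs)"
        unfolding f'_def by (intro sorted_wrt_ge_map_mono monoI) auto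
      moreover have "x - a \<le> b" if "x \<in> set (take m xs)" for x
        using xs(1) in_set_takeD[OF that] ab by (fastforce simp: box_partitions_def)
      ultimately show "f' xs \<in> box_partitions m b"
        using xs(1) k by (auto simp: box_partitions_def f'_def)
    qed
  qed
  then show ?thesis unfolding m_def b_def by blast
qed

theorem theorem4p5:
  fixes k l :: nat
  assumes "k \<ge> 1" and "l \<ge> 1"
  shows "\<exists>f. bij_betw f {xs \<in> box_partitions k l. critical_partition l xs}
                       {xs \<in> box_partitions k l. self_complementary l xs}"
proof (cases "even k \<or> even l")
  case True
  then show ?thesis
    using bij_betw_critical_partitions bij_betw_self_complementary_partitions
    by (meson bij_betw_inv_into bij_betw_trans)
next
  case False
  then have "{xs \<in> box_partitions k l. critical_partition l xs} = {}"
    and "{xs \<in> box_partitions k l. self_complementary l xs} = {}"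
    using critical_partition_imp_even self_complementary_imp_even by blast+
  then show ?thesis by (metis bij_betw_id)
qed

end
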